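(* The centralized optimization problem $$\max_{(r_{ij})}\ \prod_{i=1}^{M}\Big(\prod_{j=1}^{N_i}U_{ij}(r_{ij})^{\alpha_{ij}}\Big)^{\beta_i}\quad\text{subject to}\quad \sum_{i=1}^{M}\sum_{j=1}^{N_i} r_{ij}\le R,\qquad r_{ij}\ge 0,\ i=1,\dots,M,\ j=1,\dots,N_i,$$ is convex, in the sense that the equivalent problem obtained by replacing the objective with its logarithm $\sum_{i=1}^{M}\beta_i\sum_{j=1}^{N_i}\alpha_{ij}\log U_{ij}(r_{ij})$ is the maximization of a concave function over a convex set, and it has a unique global optimal solution.
   Context: There are $M\ge 1$ users; user $i\in\{1,\dots,M\}$ runs $N_i\ge 1$ applications, indexed by $j\in\{1,\dots,N_i\}$. $R>0$ is the total available rate, $\beta_i>0$ are subscription weights, and $\alpha_{ij}>0$ are application usage weights with $\sum_{j=1}^{N_i}\alpha_{ij}=1$ for each $i$. Each application utility $U_{ij}:[0,\infty)\to[0,\infty)$ is of one of two types: (1) sigmoidal: $U_{ij}(r)=c_{ij}\Big(\frac{1}{1+e^{-a_{ij}(r-b_{ij})}}-d_{ij}\Big)$ with $a_{ij},b_{ij}>0$, $c_{ij}=\frac{1+e^{a_{ij}b_{ij}}}{e^{a_{ij}b_{ij}}}$, $d_{ij}=\frac{1}{1+e^{a_{ij}b_{ij}}}$; (2) logarithmic: $U_{ij}(r)=\frac{\log(1+k_{ij}r)}{\log(1+k_{ij}r_{ij}^{\max})}$ with $k_{ij},r_{ij}^{\max}>0$. Convention: $\log 0=-\infty$, and concavity is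 understood for extended-valued functions. *)

theory Defs
  imports "HOL-Analysis.Analysis" "HOL-Analysis.Finite_Function_Topology"
begin

definition sigmoidal_utility :: "(real \<Rightarrow> real) \<Rightarrow> bool" where
  "sigmoidal_utility u \<longleftrightarrow>
     (\<exists>a b c d. a > 0 \<and> b > 0 \<and>
        c = (1 + exp (a * b)) / exp (a * b) \<and>
        d = 1 / (1 + exp (a * b)) \<and>
        (\<forall>r\<ge>0. u r = c * (1 / (1 + exp (- a * (r - b))) - d)))"

definition logarithmic_utility :: "(real \<Rightarrow> real) \<Rightarrow> bool" where
  "logarithmic_utility u \<longleftrightarrow>
     (\<exists>k rmax. k > 0 \<and> rmax > 0 \<and>
        (\<forall>r\<ge>0. u r = ln (1 + k * r) / ln (1 + k * rmax)))"

(* A rate allocation is a finitely supported family r indexed by pairs (i, j). The support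
   condition in feasible_rates confines it to the applications that exist, so that the
   feasible set is a copy of a subset of the Euclidean space of dimension N 1 + ... + N M. *)

type_synonym rates = "(nat \<times> nat) \<Rightarrow>\<^sub>0 real"

abbreviation rate :: "rates \<Rightarrow> nat \<Rightarrow> nat \<Rightarrow> real" where
  "rate r i j \<equiv> Poly_Mapping.lookup r (i, j)"

definition feasible_rates :: "nat \<Rightarrow> (nat \<Rightarrow> nat) \<Rightarrow> real \<Rightarrow> rates set" where
  "feasible_rates M N R =
     {r. Poly_Mapping.keys r \<subseteq> (SIGMA i:{1..M}. {1..N i}) \<and>
         (\<Sum>i=1..M. \<Sum>j=1..N i. rate r i j) \<le> R \<and>
         (\<forall>i\<in>{1..M}. \<forall>j\<in>{1..N i}. rate r i j \<ge> 0)}"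

definition objective ::
  "nat \<Rightarrow> (nat \<Rightarrow> nat) \<Rightarrow> (nat \<Rightarrow> real) \<Rightarrow> (nat \<Rightarrow> nat \<Rightarrow> real) \<Rightarrow>
   (nat \<Rightarrow> nat \<Rightarrow> real \<Rightarrow> real) \<Rightarrow> rates \<Rightarrow> real" where
  "objective M N \<beta> \<alpha> U r =
     (\<Prod>i=1..M. (\<Prod>j=1..N i. U i j (rate r i j) powr \<alpha> i j) powr \<beta> i)"

(* Only used for nonnegative arguments; the library's ln has ln 0 = 0. *)
definition ext_ln :: "real \<Rightarrow> ereal" where
  "ext_ln x = (if x \<le> 0 then - \<infinity> else ereal (ln x))"

definition log_objective ::
  "nat \<Rightarrow> (nat \<Rightarrow> nat) \<Rightarrow> (nat \<Rightarrow> real) \<Rightarrow> (nat \<Rightarrow> nat \<Rightarrow> real) \<Rightarrow>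
   (nat \<Rightarrow> nat \<Rightarrow> real \<Rightarrow> real) \<Rightarrow> rates \<Rightarrow> ereal" where
  "log_objective M N \<beta> \<alpha> U r =
     (\<Sum>i=1..M. ereal (\<beta> i) * (\<Sum>j=1..N i. ereal (\<alpha> i j) * ext_ln (U i j (rate r i j))))"

(* Concavity of a function with values in [-\<infinity>, \<infinity>). Excluding \<infinity> keeps
   the left-hand side of the inequality free of \<infinity> - \<infinity>; for u = 0 the ereal convention
   0 * (-\<infinity>) = 0 makes the inequality trivial. *)
definition ext_concave_on :: "'a::real_vector set \<Rightarrow> ('a \<Rightarrow> ereal) \<Rightarrow> bool" where
  "ext_concave_on S f \<longleftrightarrow> convex S \<and> (\<forall>x\<in>S. f x \<noteq> \<infinity>) \<and>
     (\<forall>x\<in>S. \<forall>y\<in>S. \<forall>u\<ge>0. \<forall>v\<ge>0. u + v = 1 \<longrightarrow>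
        ereal u * f x + ereal v * f y \<le> f (u *\<^sub>R x + v *\<^sub>R y))"

abbreviation global_maximizer :: "'a set \<Rightarrow> ('a \<Rightarrow> 'b::ord) \<Rightarrow> 'a \<Rightarrow> bool" where
  "global_maximizer S f x \<equiv> is_arg_max f (\<lambda>y. y \<in> S) x"

end

(*
With x = exp (a r) and E = exp (a b), a sigmoidal utility is (x - 1) / (x + E), so the derivative
of its logarithm is a (1 + 1 / (x - 1)) - a (1 - E / (x + E)), which is strictly decreasing.
Hence the logarithm of every utility, sigmoidal or logarithmic, is strictly concave on r > 0.
The objective is continuous on a compact set, so a maximizer exists. Its value is positive because
an equal split of the rate has positive value; at points of positive value all rates
are positive, so the midpoint of two distinct maximizers would do strictly better.
*)
theory Submission
  imports Defs
begin

section \<open>Strict log-concavity of the two utility types\<close>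

lemma DERIV_strict_antimono_imp_strict_concave:
  fixes f f' :: "real \<Rightarrow> real"
  assumes deriv: "\<And>x. x > 0 \<Longrightarrow> (f has_real_derivative f' x) (at x)"
    and antimono: "\<And>x y. 0 < x \<Longrightarrow> x < y \<Longrightarrow> f' y < f' x"
    and "x > 0" "y > 0" "x \<noteq> y" "s > 0" "t > 0" "s + t = 1"
  shows "s * f x + t * f y < f (s * x + t * y)"
proof -
  have *: "s * f x + t * f y < f (s * x + t * y)"
    if "0 < x" "x < y" "s > 0" "t > 0" "s + t = 1" for x y s t :: real
  proof -
    define z where "z = s * x + t * y"
    have s: "s = 1 - t"
      using that by simp
    \<comment> \<open>The mean value theorem on either side of \<open>z\<close> gives two slopes,
      the left one strictly larger. These identities yield s (z - x) = t (y - z) = s t (y - x), the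
      common positive factor that turns the comparison of slopes into one of increments.\<close>
    have zx: "z - x = t * (y - x)" and yz: "y - z = s * (y - x)"
      unfolding z_def s by (simp_all add: algebra_simps)
    have "x < z" "z < y"
      using zx yz that by (smt (verit) mult_pos_pos)+
    have "\<exists>\<xi>. x < \<xi> \<and> \<xi> < z \<and> f z - f x = (z - x) * f' \<xi>"
      using \<open>x < z\<close> \<open>0 < x\<close> by (intro MVT2 deriv) auto
    then obtain \<xi> where \<xi>: "x < \<xi>" "\<xi> < z" "f z - f x = (z - x) * f' \<xi>"
      by blast
    have "\<exists>\<eta>. z < \<eta> \<and> \<eta> < y \<and> f y - f z = (y - z) * f' \<eta>"
      using \<open>x < z\<close> \<open>z < y\<close> \<open>0 < x\<close> by (intro MVT2 deriv) auto
    then obtain \<eta> where \<eta>: "z < \<eta>" "\<eta> < y" "f y - f z = (y - z) * f' \<eta>"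
      by blast
    have "f' \<eta> < f' \<xi>"
      using \<xi> \<eta> that by (intro antimono) auto
    moreover have "s * t * (y - x) > 0"
      using that by simp
    ultimately have "s * t * (y - x) * f' \<eta> < s * t * (y - x) * f' \<xi>"
      by (rule mult_strict_left_mono)
    then have "t * (f y - f z) < s * (f z - f x)"
      unfolding \<xi>(3) \<eta>(3) zx yz by (simp add: mult_ac)
    then have "s * f x + t * f y < (s + t) * f z"
      by (simp add: algebra_simps)
    then show ?thesis
      using that by (simp add: z_def)
  qed
  show ?thesis
  proof (cases "x < y")
    case True
    with * assms show ?thesis by blast
  next
    case False
    \<comment> \<open>The situation is symmetric under swapping the points together with their
      weights.\<close>
    with *[of y x t s] assms show ?thesis by (simp add: add.commute)
  qed
qed

text \<open>The interface shared by both utility types. Concavity is asked only at positive rates,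
  because \<open>u 0 = 0\<close> and \<open>ln 0\<close> is a mere default value; continuity
  includes 0, since existence of a maximizer is argued on a set containing zero rates.\<close>

definition log_concave_utility :: "(real \<Rightarrow> real) \<Rightarrow> bool" where
  "log_concave_utility u \<longleftrightarrow>
     u 0 = 0 \<and> continuous_on {0..} u \<and> (\<forall>r>0. u r > 0) \<and>
     (\<forall>x>0. \<forall>y>0. \<forall>s>0. \<forall>t>0. x \<noteq> y \<longrightarrow> s + t = 1 \<longrightarrow>
        s * ln (u x) + t * ln (u y) < ln (u (s * x + t * y)))"

text \<open>The utility predicates determine a function only at nonnegative rates, so a closed form
  can be exchanged for it only there.\<close>

lemma log_concave_utility_cong:
  assumes "log_concave_utility u" "\<And>r. r \<ge> 0 \<Longrightarrow> v r = u r"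
  shows "log_concave_utility v"
proof -
  have "continuous_on {0..} v \<longleftrightarrow> continuous_on {0..} u"
    by (rule continuous_on_cong) (auto simp: assms(2))
  then show ?thesis
    using assms by (simp add: log_concave_utility_def add_nonneg_nonneg)
qed

lemma sigmoidal_imp_log_concave_utility:
  assumes "sigmoidal_utility u"
  shows "log_concave_utility u"
proof -
  obtain a b c d where ab: "a > 0" "b > 0"
    and c: "c = (1 + exp (a * b)) / exp (a * b)" and d: "d = 1 / (1 + exp (a * b))"
    and u: "\<And>r. r \<ge> 0 \<Longrightarrow> u r = c * (1 / (1 + exp (- a * (r - b))) - d)"
    using assms unfolding sigmoidal_utility_def by blast
  define E where "E = exp (a * b)"
  have "E > 0"
    by (simp add: E_def)
  \<comment> \<open>The sigmoid with \<open>c\<close> and \<open>d\<close> cancelled; the numerator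
    shows the zero at 0 and the sign for positive rates.\<close>
  define v where "v r = (exp (a * r) - 1) / (exp (a * r) + E)" for r
  have pos: "exp (a * r) > 1" if "r > 0" for r
    using that ab by simp
  have den: "exp (a * r) + E > 0" for r
    using \<open>E > 0\<close> by (simp add: add_pos_pos)
  have "u r = v r" if "r \<ge> 0" for r
  proof -
    have e: "exp (- a * (r - b)) = E / exp (a * r)"
      by (simp add: E_def exp_diff[symmetric] algebra_simps)
    define x where "x = exp (a * r)"
    have "x > 0" by (simp add: x_def)
    have "u r = (1 + E) / E * (1 / (1 + E / x) - 1 / (1 + E))"
      unfolding u[OF that] c d e E_def[symmetric] x_def ..
    also have "1 / (1 + E / x) - 1 / (1 + E) = E * (x - 1) / ((x + E) * (1 + E))"
      using \<open>x > 0\<close> \<open>E > 0\<close> by (simp add: divide_simps) (simp add: algebra_simps add_eq_0_iff)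
    also have "(1 + E) / E * (E * (x - 1) / ((x + E) * (1 + E))) = (x - 1) / (x + E)"
      using \<open>x > 0\<close> \<open>E > 0\<close> by (simp add: divide_simps)
    finally show ?thesis
      by (simp add: v_def x_def)
  qed
  moreover have "log_concave_utility v"
    unfolding log_concave_utility_def
  proof (intro conjI allI impI)
    show "v 0 = 0"
      by (simp add: v_def)
    show "continuous_on {0..} v"
      unfolding v_def using den by (intro continuous_intros) (simp add: less_imp_neq[symmetric])
    show "v r > 0" if "r > 0" for r
      using pos[OF that] den[of r] by (simp add: v_def)
    fix x y s t :: real
    assume *: "x > 0" "y > 0" "s > 0" "t > 0" "x \<noteq> y" "s + t = 1"
    \<comment> \<open>The derivative of ln (v r), split so that the rate enters only through 1 / (X
      - 1) and E / (X + E) with X = exp (a r); both fall as X grows.\<close>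
    define g' where "g' r = a * (1 + 1 / (exp (a * r) - 1)) - a * (1 - E / (exp (a * r) + E))" for r
    show "s * ln (v x) + t * ln (v y) < ln (v (s * x + t * y))"
    proof (rule DERIV_strict_antimono_imp_strict_concave[where f = "\<lambda>r. ln (v r)" and f' = g'])
      fix r :: real
      assume "r > 0"
      have *: "a * (1 + 1 / (X - 1)) = a * X / (X - 1)" if "X > 1" for X
        using that by (simp add: field_simps)
      have **: "a * (1 - E / (X + E)) = a * X / (X + E)" if "X + E > 0" for X
        using that by (simp add: field_simps)
      have g'_eq: "g' r = a * exp (a * r) / (exp (a * r) - 1) - a * exp (a * r) / (exp (a * r) + E)"
        unfolding g'_def *[OF pos[OF \<open>r > 0\<close>]] **[OF den[of r]] ..
      have "((\<lambda>r. ln (exp (a * r) - 1) - ln (exp (a * r) + E)) has_real_derivative g' r) (at r)"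
        unfolding g'_eq using pos[OF \<open>r > 0\<close>] den[of r]
        by (auto intro!: derivative_eq_intros simp: mult.commute)
      then show "((\<lambda>r. ln (v r)) has_real_derivative g' r) (at r)"
        \<comment> \<open>The logarithm of the quotient splits only where the numerator is positive,
          that is, on the open half-line r > 0.\<close>
        by (rule has_field_derivative_transform_within_open[where S = "{0<..}"])
          (use ab pos den[THEN less_imp_neq[THEN not_sym]] \<open>r > 0\<close> in \<open>simp_all add: v_def ln_div\<close>)
    next
      fix x y :: real
      assume "0 < x" "x < y"
      then have "exp (a * x) < exp (a * y)"
        using ab by simp
      then have "1 / (exp (a * y) - 1) < 1 / (exp (a * x) - 1)"
        and "E / (exp (a * y) + E) < E / (exp (a * x) + E)"
        using pos[OF \<open>0 < x\<close>] den \<open>E > 0\<close> by (auto intro!: divide_strict_left_mono mult_pos_pos)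
      then have "1 / (exp (a * y) - 1) + E / (exp (a * y) + E)
          < 1 / (exp (a * x) - 1) + E / (exp (a * x) + E)"
        by (rule add_strict_mono)
      then have "a * (1 / (exp (a * y) - 1) + E / (exp (a * y) + E))
          < a * (1 / (exp (a * x) - 1) + E / (exp (a * x) + E))"
        using ab by simp
      then show "g' y < g' x"
        unfolding g'_def by (simp add: ring_distribs)
    qed (use * in auto)
  qed
  ultimately show ?thesis
    by (rule log_concave_utility_cong[rotated])
qed

text \<open>Up to the constant ln L, the logarithm of the utility is ln (ln (1 + k r)). Its
  derivative k / ((1 + k r) ln (1 + k r)) decreases strictly, as the denominator is a product of two
  positive increasing factors.\<close>

lemma logarithmic_imp_log_concave_utility:
  assumes "logarithmic_utility u"
  shows "log_concave_utility u"
proof -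
  obtain k rmax where k: "k > 0" "rmax > 0"
    and u: "\<And>r. r \<ge> 0 \<Longrightarrow> u r = ln (1 + k * r) / ln (1 + k * rmax)"
    using assms unfolding logarithmic_utility_def by blast
  define L where "L = ln (1 + k * rmax)"
  have "L > 0"
    using k by (simp add: L_def add_pos_pos)
  define v where "v r = ln (1 + k * r) / L" for r
  have pos: "ln (1 + k * r) > 0" "1 + k * r > 0" if "r > 0" for r
    using that k by (auto simp: add_pos_pos)
  have "log_concave_utility v"
    unfolding log_concave_utility_def
  proof (intro conjI allI impI)
    show "v 0 = 0"
      by (simp add: v_def)
    show "continuous_on {0..} v"
      unfolding v_def using k \<open>L > 0\<close>
      by (intro continuous_intros) (auto simp: add_nonneg_eq_0_iff)
    show "v r > 0" if "r > 0" for r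
      using pos[OF that] \<open>L > 0\<close> by (simp add: v_def)
    fix x y s t :: real
    assume *: "x > 0" "y > 0" "s > 0" "t > 0" "x \<noteq> y" "s + t = 1"
    define g' where "g' r = k / ((1 + k * r) * ln (1 + k * r))" for r
    show "s * ln (v x) + t * ln (v y) < ln (v (s * x + t * y))"
    proof (rule DERIV_strict_antimono_imp_strict_concave[where f = "\<lambda>r. ln (v r)" and f' = g'])
      fix r :: real
      assume "r > 0"
      have "((\<lambda>r. ln (ln (1 + k * r)) - ln L) has_real_derivative g' r) (at r)"
        unfolding g'_def using pos[OF \<open>r > 0\<close>]
        by (auto intro!: derivative_eq_intros simp: field_simps)
      then show "((\<lambda>r. ln (v r)) has_real_derivative g' r) (at r)"
        by (rule has_field_derivative_transform_within_open[where S = "{0<..}"])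
          (use k pos \<open>L > 0\<close> \<open>r > 0\<close> in \<open>simp_all add: v_def ln_div\<close>)
    next
      fix x y :: real
      assume "0 < x" "x < y"
      then have "1 + k * x < 1 + k * y"
        using k by simp
      moreover from this have "ln (1 + k * x) < ln (1 + k * y)"
        using pos(2)[OF \<open>0 < x\<close>] by (subst ln_less_cancel_iff) linarith+
      ultimately have "(1 + k * x) * ln (1 + k * x) < (1 + k * y) * ln (1 + k * y)"
        using pos[OF \<open>0 < x\<close>] by (intro mult_strict_mono) auto
      then show "g' y < g' x"
        unfolding g'_def using k pos \<open>0 < x\<close> \<open>x < y\<close>
        by (intro divide_strict_left_mono) (auto intro!: mult_pos_pos)
    qed (use * in auto)
  qed
  then show ?thesis
    by (rule log_concave_utility_cong) (simp add: u v_def L_def)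
qed

lemma log_concave_utility_nonneg:
  assumes "log_concave_utility u" "r \<ge> 0"
  shows "u r \<ge> 0"
  using assms by (cases "r = 0") (auto simp: log_concave_utility_def less_imp_le)

section \<open>The extended logarithm of weighted products\<close>

lemma ext_ln_mult:
  assumes "x \<ge> 0" "y \<ge> 0"
  shows "ext_ln (x * y) = ext_ln x + ext_ln y"
  using assms by (auto simp: ext_ln_def ln_mult mult_le_0_iff)

text \<open>Positivity of \<open>w\<close> matters at x = 0: both sides are then minus infinity,
  whereas w = 0 would make the right side 0.\<close>

lemma ext_ln_powr:
  assumes "x \<ge> 0" "w > 0"
  shows "ext_ln (x powr w) = ereal w * ext_ln x"
  using assms by (auto simp: ext_ln_def ln_powr)

lemma ext_ln_weighted_prod:
  assumes "\<And>a. a \<in> A \<Longrightarrow> w a > 0" "\<And>a. a \<in> A \<Longrightarrow> x a \<ge> 0"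
  shows "(\<Sum>a\<in>A. ereal (w a) * ext_ln (x a)) = ext_ln (\<Prod>a\<in>A. x a powr w a)"
  using assms
proof (induction A rule: infinite_finite_induct)
  case (insert a A)
  then show ?case
    by (simp add: ext_ln_mult ext_ln_powr prod_nonneg)
qed (auto simp: ext_ln_def)

lemma ext_ln_less_iff:
  assumes "x \<ge> 0" "y \<ge> 0"
  shows "ext_ln x < ext_ln y \<longleftrightarrow> x < y"
  using assms by (auto simp: ext_ln_def)

section \<open>The feasible set: compactness and convexity\<close>

lemma lookup_scaleR [simp]:
  fixes x :: "'a \<Rightarrow>\<^sub>0 real"
  shows "Poly_Mapping.lookup (c *\<^sub>R x) p = c * Poly_Mapping.lookup x p"
proof -
  have "finite {p. c * Poly_Mapping.lookup x p \<noteq> 0}"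
    by (rule finite_subset[OF _ finite_lookup[of x]]) auto
  then show ?thesis
    by (simp add: scaleR_poly_mapping_def)
qed

text \<open>Working with plain functions makes Tychonoff's theorem available: \<open>B\<close> is a
  closed part of a product of compact sets. Continuity is required only on the nonnegative orthant,
  where the utilities are known to be continuous.\<close>

lemma continuous_attains_max_on_budget_set:
  fixes F :: "('a \<Rightarrow> real) \<Rightarrow> real"
  assumes "finite I" "R \<ge> 0" and cont: "continuous_on {g. \<forall>p\<in>I. g p \<ge> 0} F"
  defines "B \<equiv> {g. (\<forall>p\<in>I. g p \<ge> 0) \<and> (\<forall>p. p \<notin> I \<longrightarrow> g p = 0) \<and> (\<Sum>p\<in>I. g p) \<le> R}"
  shows "\<exists>g\<in>B. \<forall>h\<in>B. F h \<le> F g"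
proof -
  \<comment> \<open>Nonnegative rates with total at most \<open>R\<close> are each at most
    \<open>R\<close>; the factors {0} pin the coordinates outside \<open>I\<close>.\<close>
  define K where "K = (\<Pi>\<^sub>E p\<in>UNIV. if p \<in> I then {0..R} else {0})"
  have "compactin (product_topology (\<lambda>_. euclidean) UNIV) K"
    unfolding K_def compactin_PiE by auto
  then have "compact K"
    by (simp add: euclidean_product_topology)
  moreover have "closed {g :: 'a \<Rightarrow> real. (\<Sum>p\<in>I. g p) \<le> R}"
    by (intro closed_Collect_le continuous_intros continuous_on_product_coordinates)
  moreover have "B = K \<inter> {g. (\<Sum>p\<in>I. g p) \<le> R}"
  proof -
    have "g p \<le> R" if "\<forall>p\<in>I. g p \<ge> 0" "(\<Sum>p\<in>I. g p) \<le> R" "p \<in> I" for g :: "'a \<Rightarrow> real" and p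
      using member_le_sum[of p I g] that \<open>finite I\<close> by force
    then show ?thesis
      by (auto simp: B_def K_def PiE_iff split: if_splits)
  qed
  ultimately have "compact B"
    by (simp add: compact_Int_closed)
  moreover have "(\<lambda>_. 0) \<in> B"
    using \<open>R \<ge> 0\<close> by (simp add: B_def)
  moreover have "continuous_on B F"
    by (rule continuous_on_subset[OF cont]) (auto simp: B_def)
  ultimately show ?thesis
    using continuous_attains_sup by blast
qed

text \<open>Flattens the nested indices to pairs and brings feasibility into the form of the budget
  set \<open>B\<close> above.\<close>

lemma feasible_rates_iff:
  defines "I \<equiv> \<lambda>M N. SIGMA i:{1..M}. {1..N i}"
  shows "r \<in> feasible_rates M N R \<longleftrightarrow>
    (\<forall>p\<in>I M N. Poly_Mapping.lookup r p \<ge> 0) \<and>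
    (\<forall>p. p \<notin> I M N \<longrightarrow> Poly_Mapping.lookup r p = 0) \<and>
    (\<Sum>p\<in>I M N. Poly_Mapping.lookup r p) \<le> R"
  unfolding feasible_rates_def I_def
  by (auto simp: sum.Sigma in_keys_iff subset_iff split_beta)

lemma convex_feasible_rates: "convex (feasible_rates M N R)"
proof (rule convexI)
  fix x y :: rates and s t :: real
  assume xy: "x \<in> feasible_rates M N R" "y \<in> feasible_rates M N R"
    and st: "0 \<le> s" "0 \<le> t" "s + t = 1"
  let ?I = "SIGMA i:{1..M}. {1..N i}"
  have "s * (\<Sum>p\<in>?I. Poly_Mapping.lookup x p) + t * (\<Sum>p\<in>?I. Poly_Mapping.lookup y p) \<le> R"
    using xy st by (intro convex_bound_le) (auto simp: feasible_rates_iff)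
  then show "s *\<^sub>R x + t *\<^sub>R y \<in> feasible_rates M N R"
    using xy st
    by (auto simp: feasible_rates_iff lookup_add sum.distrib sum_distrib_left)
qed

section \<open>Strict log-concavity of the objective\<close>

lemma weighted_prod_strict_log_concave:
  fixes u :: "'a \<Rightarrow> real \<Rightarrow> real" and x y w :: "'a \<Rightarrow> real"
  assumes "finite I" and w: "\<And>p. p \<in> I \<Longrightarrow> w p > 0"
    and u: "\<And>p. p \<in> I \<Longrightarrow> log_concave_utility (u p)"
    and pos: "\<And>p. p \<in> I \<Longrightarrow> x p > 0" "\<And>p. p \<in> I \<Longrightarrow> y p > 0"
    and neq: "\<exists>p\<in>I. x p \<noteq> y p" and st: "s > 0" "t > 0" "s + t = 1"
  shows "s * ln (\<Prod>p\<in>I. u p (x p) powr w p) + t * ln (\<Prod>p\<in>I. u p (y p) powr w p)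
    < ln (\<Prod>p\<in>I. u p (s * x p + t * y p) powr w p)"
proof -
  have u_pos: "u p r > 0" if "p \<in> I" "r > 0" for p r
    using u that by (auto simp: log_concave_utility_def)
  have ln_prod: "ln (\<Prod>p\<in>I. u p (g p) powr w p) = (\<Sum>p\<in>I. w p * ln (u p (g p)))"
    if "\<And>p. p \<in> I \<Longrightarrow> g p > 0" for g
    using that u_pos \<open>finite I\<close> by (subst ln_prod) (force intro!: sum.cong simp: ln_powr)+
  have strict: "w p * (s * ln (u p (x p)) + t * ln (u p (y p)))
      < w p * ln (u p (s * x p + t * y p))" if "p \<in> I" "x p \<noteq> y p" for p
    using u[OF that(1)] w pos st that by (simp add: log_concave_utility_def)
  have eq: "w p * (s * ln (u p (x p)) + t * ln (u p (y p)))
      = w p * ln (u p (s * x p + t * y p))" if "x p = y p" for p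
    using that st by (simp add: distrib_right[symmetric])
  \<comment> \<open>Coordinates where \<open>x\<close> and \<open>y\<close> agree give equality, the
    others a strict gain, and \<open>neq\<close> supplies at least one of the latter.\<close>
  have "(\<Sum>p\<in>I. w p * (s * ln (u p (x p)) + t * ln (u p (y p))))
      < (\<Sum>p\<in>I. w p * ln (u p (s * x p + t * y p)))"
    using neq strict eq by (intro sum_strict_mono_ex1 \<open>finite I\<close>) (metis order.refl less_imp_le)+
  then show ?thesis
    using pos st
    by (simp add: ln_prod add_pos_pos sum.distrib sum_distrib_left algebra_simps)
qed

text \<open>Values of \<open>powr\<close> are nonnegative, so the outer power distributes over the
  inner product and the exponents multiply.\<close>

lemma objective_eq_prod_Sigma:
  "objective M N \<beta> \<alpha> U r =
     (\<Prod>p\<in>(SIGMA i:{1..M}. {1..N i}).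
        U (fst p) (snd p) (Poly_Mapping.lookup r p) powr (\<alpha> (fst p) (snd p) * \<beta> (fst p)))"
  unfolding objective_def
  by (simp add: prod_powr_distrib powr_powr prod.Sigma split_beta)

lemma objective_nonneg: "objective M N \<beta> \<alpha> U r \<ge> 0"
  unfolding objective_def by (simp add: prod_nonneg)

section \<open>Concavity, existence and uniqueness for the rate allocation problem\<close>

theorem mainTheorem3:
  fixes M :: nat and N :: "nat \<Rightarrow> nat" and R :: real
    and \<beta> :: "nat \<Rightarrow> real" and \<alpha> :: "nat \<Rightarrow> nat \<Rightarrow> real"
    and U :: "nat \<Rightarrow> nat \<Rightarrow> real \<Rightarrow> real"
  assumes "M \<ge> 1"
    and "\<And>i. i \<in> {1..M} \<Longrightarrow> N i \<ge> 1"
    and "R > 0"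
    and "\<And>i. i \<in> {1..M} \<Longrightarrow> \<beta> i > 0"
    and "\<And>i j. i \<in> {1..M} \<Longrightarrow> j \<in> {1..N i} \<Longrightarrow> \<alpha> i j > 0"
    and "\<And>i. i \<in> {1..M} \<Longrightarrow> (\<Sum>j=1..N i. \<alpha> i j) = 1"
    and "\<And>i j. i \<in> {1..M} \<Longrightarrow> j \<in> {1..N i} \<Longrightarrow>
           sigmoidal_utility (U i j) \<or> logarithmic_utility (U i j)"
  shows "convex (feasible_rates M N R)
    \<and> (\<forall>r\<in>feasible_rates M N R.
         log_objective M N \<beta> \<alpha> U r = ext_ln (objective M N \<beta> \<alpha> U r))
    \<and> (\<forall>r. global_maximizer (feasible_rates M N R) (objective M N \<beta> \<alpha> U) r \<longleftrightarrow>
           global_maximizer (feasible_rates M N R) (log_objective M N \<beta> \<alpha> U) r)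
    \<and> ext_concave_on (feasible_rates M N R) (log_objective M N \<beta> \<alpha> U)
    \<and> (\<exists>!r. global_maximizer (feasible_rates M N R) (objective M N \<beta> \<alpha> U) r)"
proof -
  define I where "I = (SIGMA i:{1..M}. {1..N i})"
  define w where "w p = \<alpha> (fst p) (snd p) * \<beta> (fst p)" for p
  define u where "u p = U (fst p) (snd p)" for p
  define F where "F = feasible_rates M N R"
  define obj where "obj = objective M N \<beta> \<alpha> U"
  have "finite I"
    by (simp add: I_def)
  have w: "w p > 0" if "p \<in> I" for p
    using that assms(4,5) by (auto simp: I_def w_def)
  have u: "log_concave_utility (u p)" if "p \<in> I" for p
    using that assms(7)[of "fst p" "snd p"]
      sigmoidal_imp_log_concave_utility logarithmic_imp_log_concave_utility
    by (auto simp: I_def u_def)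
  have F_iff: "r \<in> F \<longleftrightarrow> (\<forall>p\<in>I. Poly_Mapping.lookup r p \<ge> 0) \<and>
      (\<forall>p. p \<notin> I \<longrightarrow> Poly_Mapping.lookup r p = 0) \<and> (\<Sum>p\<in>I. Poly_Mapping.lookup r p) \<le> R" for r
    unfolding F_def I_def by (rule feasible_rates_iff)
  have obj_eq: "obj r = (\<Prod>p\<in>I. u p (Poly_Mapping.lookup r p) powr w p)" for r
    unfolding obj_def I_def u_def w_def by (rule objective_eq_prod_Sigma)
  have obj_nonneg: "obj r \<ge> 0" for r
    by (simp add: obj_def objective_nonneg)
  have convex: "convex F"
    unfolding F_def by (rule convex_feasible_rates)

  \<comment> \<open>A zero rate has zero utility, and this single factor annihilates the whole
    product.\<close>
  have rate_pos: "Poly_Mapping.lookup r p > 0" if "r \<in> F" "obj r > 0" "p \<in> I" for r p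
  proof (rule ccontr)
    assume "\<not> Poly_Mapping.lookup r p > 0"
    then have "u p (Poly_Mapping.lookup r p) = 0"
      using that u F_iff by (metis log_concave_utility_def order.not_eq_order_implies_strict)
    then have "obj r = 0"
      unfolding obj_eq using that \<open>finite I\<close> by (auto simp: prod_zero_iff)
    with that show False by simp
  qed
  have obj_pos: "obj r > 0" if "\<And>p. p \<in> I \<Longrightarrow> Poly_Mapping.lookup r p > 0" for r
    unfolding obj_eq using that u by (intro prod_pos) (force simp: log_concave_utility_def)
  have strict: "s * ln (obj x) + t * ln (obj y) < ln (obj (s *\<^sub>R x + t *\<^sub>R y))"
    "obj (s *\<^sub>R x + t *\<^sub>R y) > 0"
    if "x \<in> F" "y \<in> F" "obj x > 0" "obj y > 0" "x \<noteq> y" "s > 0" "t > 0" "s + t = 1" for x y s t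
  proof -
    \<comment> \<open>Feasible allocations vanish outside \<open>I\<close>, so distinct ones must
      differ at a pair inside it.\<close>
    have "\<exists>p\<in>I. Poly_Mapping.lookup x p \<noteq> Poly_Mapping.lookup y p"
      using that(1,2,5) F_iff by (metis poly_mapping_eqI)
    then show "s * ln (obj x) + t * ln (obj y) < ln (obj (s *\<^sub>R x + t *\<^sub>R y))"
      unfolding obj_eq lookup_add lookup_scaleR
      using that rate_pos w u \<open>finite I\<close> by (intro weighted_prod_strict_log_concave) auto
    show "obj (s *\<^sub>R x + t *\<^sub>R y) > 0"
      using that rate_pos by (intro obj_pos) (simp add: lookup_add add_pos_pos)
  qed

  have log_obj: "log_objective M N \<beta> \<alpha> U r = ext_ln (obj r)" if "r \<in> F" for r
  proof -
    have nonneg: "U i j (rate r i j) \<ge> 0" if "i \<in> {1..M}" "j \<in> {1..N i}" for i j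
    proof -
      have ij: "(i, j) \<in> I"
        using that by (simp add: I_def)
      then have "rate r i j \<ge> 0"
        using \<open>r \<in> F\<close> F_iff by blast
      then show ?thesis
        using log_concave_utility_nonneg[OF u[OF ij]] by (simp add: u_def)
    qed
    \<comment> \<open>The weighted product rule is applied twice: here to the applications of one
      user, then to the users.\<close>
    have "(\<Sum>j=1..N i. ereal (\<alpha> i j) * ext_ln (U i j (rate r i j)))
        = ext_ln (\<Prod>j=1..N i. U i j (rate r i j) powr \<alpha> i j)" if "i \<in> {1..M}" for i
      using assms(5)[OF that] nonneg[OF that] by (rule ext_ln_weighted_prod)
    then have "log_objective M N \<beta> \<alpha> U r =
        (\<Sum>i=1..M. ereal (\<beta> i) * ext_ln (\<Prod>j=1..N i. U i j (rate r i j) powr \<alpha> i j))"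
      unfolding log_objective_def by (intro sum.cong) simp_all
    also have "\<dots> = ext_ln (obj r)"
      unfolding obj_def objective_def using assms(4)
      by (intro ext_ln_weighted_prod) (auto intro: prod_nonneg)
    finally show ?thesis .
  qed

  \<comment> \<open>A maximizer is a feasible point that no feasible point strictly exceeds, and
    \<open>ext_ln\<close> preserves and reflects strict order on nonnegative values.\<close>
  have arg_max_iff: "global_maximizer F obj r \<longleftrightarrow> global_maximizer F (log_objective M N \<beta> \<alpha> U) r" for r
    unfolding is_arg_max_def using log_obj ext_ln_less_iff[OF obj_nonneg obj_nonneg] by auto

  have concave: "ext_concave_on F (log_objective M N \<beta> \<alpha> U)"
    unfolding ext_concave_on_def
  proof (intro conjI ballI allI impI convex)
    show "log_objective M N \<beta> \<alpha> U x \<noteq> \<infinity>" if "x \<in> F" for x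
      using that by (simp add: log_obj ext_ln_def)
    fix x y and s t :: real
    assume xy: "x \<in> F" "y \<in> F" and st: "s \<ge> 0" "t \<ge> 0" "s + t = 1"
    have z: "s *\<^sub>R x + t *\<^sub>R y \<in> F"
      using convex xy st by (simp add: convex_def)
    \<comment> \<open>Zero weights rely on 0 times minus infinity being 0. With both weights
      positive, an objective value 0 makes the left side minus infinity; distinct points of positive
      value fall under \<open>strict\<close>.\<close>
    consider "s = 0" "t = 1" | "s = 1" "t = 0" | "s > 0" "t > 0" "x = y"
      | "s > 0" "t > 0" "x \<noteq> y" "obj x = 0 \<or> obj y = 0"
      | "s > 0" "t > 0" "x \<noteq> y" "obj x > 0" "obj y > 0"
      using st obj_nonneg[of x] obj_nonneg[of y] by linarith
    then have "ereal s * ext_ln (obj x) + ereal t * ext_ln (obj y) \<le> ext_ln (obj (s *\<^sub>R x + t *\<^sub>R y))"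
    proof cases
      case 3
      then have "s *\<^sub>R x + t *\<^sub>R y = x"
        using st by (simp add: scaleR_add_left[symmetric])
      then show ?thesis
        using 3 st by (simp add: ext_ln_def distrib_right[symmetric])
    next
      case 4
      then show ?thesis
        by (auto simp: ext_ln_def)
    next
      case 5
      then show ?thesis
        using strict[of x y s t] xy st by (simp add: ext_ln_def)
    qed (simp_all add: zero_ereal_def[symmetric] one_ereal_def[symmetric])
    then show "ereal s * log_objective M N \<beta> \<alpha> U x + ereal t * log_objective M N \<beta> \<alpha> U y
        \<le> log_objective M N \<beta> \<alpha> U (s *\<^sub>R x + t *\<^sub>R y)"
      using xy z by (simp add: log_obj)
  qed

  \<comment> \<open>The way back from plain functions supported in \<open>I\<close> to rate
    allocations.\<close>
  have mapping: "\<exists>r. Poly_Mapping.lookup r = g" if "\<forall>p. p \<notin> I \<longrightarrow> g p = 0" for g :: "nat \<times> nat \<Rightarrow> real"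
  proof -
    have "finite {p. g p \<noteq> 0}"
      by (rule finite_subset[OF _ \<open>finite I\<close>]) (use that in auto)
    then show ?thesis
      using lookup_Abs_poly_mapping by blast
  qed

  have positive: "\<exists>r\<in>F. obj r > 0"
  proof -
    \<comment> \<open>The 1 keeps the denominator positive, and the total of the equal rates stays
      within \<open>R\<close>.\<close>
    define q where "q = R / (1 + card I)"
    have "q > 0" "card I * q \<le> R"
      using assms(3) by (auto simp: q_def field_simps)
    obtain r where r: "Poly_Mapping.lookup r = (\<lambda>p. if p \<in> I then q else 0)"
      using mapping[of "\<lambda>p. if p \<in> I then q else 0"] by auto
    show ?thesis
      using r \<open>q > 0\<close> \<open>card I * q \<le> R\<close> by (intro bexI[of _ r] obj_pos) (simp_all add: F_iff)
  qed

  have existence: "\<exists>r. global_maximizer F obj r"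
  proof -
    let ?P = "\<lambda>g. \<Prod>p\<in>I. u p (g p) powr w p"
    let ?B = "{g. (\<forall>p\<in>I. g p \<ge> 0) \<and> (\<forall>p. p \<notin> I \<longrightarrow> g p = 0) \<and> (\<Sum>p\<in>I. g p) \<le> R}"
    have "continuous_on {g. \<forall>p\<in>I. g p \<ge> 0} ?P"
    proof (rule continuous_on_prod)
      fix p
      assume "p \<in> I"
      have "continuous_on {0..} (u p)"
        using u[OF \<open>p \<in> I\<close>] by (simp add: log_concave_utility_def)
      moreover have "continuous_on {g. \<forall>p\<in>I. g p \<ge> 0} (\<lambda>g :: nat \<times> nat \<Rightarrow> real. g p)"
        by (rule continuous_on_subset[OF continuous_on_product_coordinates]) simp
      ultimately have "continuous_on {g. \<forall>p\<in>I. g p \<ge> 0} (\<lambda>g. u p (g p))"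
        by (rule continuous_on_compose2) (use \<open>p \<in> I\<close> in auto)
      then show "continuous_on {g. \<forall>p\<in>I. g p \<ge> 0} (\<lambda>g. u p (g p) powr w p)"
        \<comment> \<open>Where a utility is 0, continuity of the power rests on the exponent
          \<open>w p\<close> being positive.\<close>
        by (rule continuous_on_powr')
          (use w[OF \<open>p \<in> I\<close>] log_concave_utility_nonneg[OF u[OF \<open>p \<in> I\<close>]] \<open>p \<in> I\<close> in auto)
    qed
    then obtain g where g: "g \<in> ?B" "\<forall>h\<in>?B. ?P h \<le> ?P g"
      using continuous_attains_max_on_budget_set[OF \<open>finite I\<close>, of R ?P] assms(3) by auto
    obtain r where r: "Poly_Mapping.lookup r = g"
      using mapping[of g] g by auto
    have F_B: "y \<in> F \<longleftrightarrow> Poly_Mapping.lookup y \<in> ?B" for y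
      unfolding F_iff by simp
    have "obj y \<le> obj r" if "y \<in> F" for y
      using g(2) that unfolding obj_eq r F_B by blast
    moreover have "r \<in> F"
      using g(1) unfolding F_B r .
    ultimately have "global_maximizer F obj r"
      by (simp add: is_arg_max_def not_less)
    then show ?thesis ..
  qed

  have uniqueness: "x = y" if max: "global_maximizer F obj x" "global_maximizer F obj y" for x y
  proof (rule ccontr)
    assume "x \<noteq> y"
    have xy: "x \<in> F" "y \<in> F" "obj x = obj y"
      using max by (auto simp: is_arg_max_def not_less intro: antisym)
    have "obj x > 0"
      using max(1) positive by (auto simp: is_arg_max_def not_less intro: less_le_trans)
    define z where "z = (1/2) *\<^sub>R x + (1/2) *\<^sub>R y"
    have "(1/2) * ln (obj x) + (1/2) * ln (obj y) < ln (obj z)" "obj z > 0"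
      unfolding z_def using xy \<open>x \<noteq> y\<close> \<open>obj x > 0\<close> by (intro strict; simp)+
    \<comment> \<open>Equal values collapse the average to ln (obj x). Positivity of
      \<open>obj z\<close> is needed to remove the logarithms, since \<open>ln 0\<close> is 0 by
      default.\<close>
    then have "obj x < obj z"
      using xy \<open>obj x > 0\<close> by simp
    moreover have "z \<in> F"
      unfolding z_def using convex xy by (intro convexD) auto
    ultimately show False
      using max(1) by (auto simp: is_arg_max_def)
  qed

  show ?thesis
    using convex log_obj arg_max_iff concave existence uniqueness
    unfolding F_def obj_def by blast
qed

end
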